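(* Let $n\geq 2$ be an integer. Then $$J_{n-2} < \left(\sum_{k=n}^{\infty} \frac{1}{J_{k}}\right)^{-1} < 4\,(J_{n-2}+1).$$
   Context: The Jacobsthal numbers $(J_n)_{n\ge 0}$ are defined by $J_0=0$, $J_1=1$ and $J_{n+2}=J_{n+1}+2J_n$ for $n\ge 0$; the first terms are $0,1,1,3,5,11,21,43,85,\dots$. *)

theory Defs
  imports Complex_Main
begin

fun jacobsthal :: "nat \<Rightarrow> nat" where
  "jacobsthal 0 = 0"
| "jacobsthal (Suc 0) = 1"
| "jacobsthal (Suc (Suc n)) = jacobsthal (Suc n) + 2 * jacobsthal n"

end

(* Put m = n - 2. The recurrence gives J_(m+2+k) >= 2^k (2 J_m + 1/2), so the tail is at most the
   geometric sum 2 / (2 J_m + 1/2) and its inverse is at least J_m + 1/4. For the upper bound the first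
   term of the tail suffices, because J_(m+2) <= 4 J_m + 1. *)

theory Submission
  imports Defs
begin

lemma jacobsthal_Suc_pos: "1 \<le> jacobsthal (Suc n)"
  by (induction n rule: jacobsthal.induct) auto

lemma jacobsthal_le_Suc: "jacobsthal n \<le> jacobsthal (Suc n)"
  by (cases n) auto

text \<open>The difference \<open>jacobsthal (Suc n) - 2 * jacobsthal n\<close> is always 1 or -1
  and changes sign at each step. Each bound at \<open>Suc n\<close> follows from the other one at
  \<open>n\<close>, so the two are proved together.\<close>

lemma jacobsthal_Suc_bounds:
  "jacobsthal (Suc n) \<le> 2 * jacobsthal n + 1 \<and> 2 * jacobsthal n \<le> jacobsthal (Suc n) + 1"
  by (induction n) auto

text \<open>The powers of 2 satisfy the same recurrence, since 2 is a root of x^2 = x + 2. A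
  two-step induction therefore carries the bound on from k = 0 and k = 1. Both sides are doubled to
  stay within the naturals.\<close>

lemma jacobsthal_geometric_lower_bound:
  "2 ^ k * (4 * jacobsthal m + 1) \<le> 2 * jacobsthal (m + 2 + k)"
proof (induction k rule: jacobsthal.induct)
  case 1
  show ?case
    using jacobsthal_Suc_pos[of m] by simp
next
  case 2
  have "jacobsthal (m + 2 + Suc 0) = 3 * jacobsthal (Suc m) + 2 * jacobsthal m"
    by (simp add: numeral_eq_Suc)
  thus ?case
    using jacobsthal_Suc_pos[of m] jacobsthal_le_Suc[of m] by simp
next
  case (3 k)
  have "2 ^ Suc (Suc k) * (4 * jacobsthal m + 1) =
      2 ^ Suc k * (4 * jacobsthal m + 1) + 2 * (2 ^ k * (4 * jacobsthal m + 1))"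
    by (simp add: algebra_simps)
  also have "\<dots> \<le> 2 * jacobsthal (m + 2 + Suc k) + 2 * (2 * jacobsthal (m + 2 + k))"
    using 3 by linarith
  also have "\<dots> = 2 * jacobsthal (m + 2 + Suc (Suc k))"
    by simp
  finally show ?case .
qed

theorem theorem2p1:
  fixes n :: nat
  assumes "n \<ge> 2"
  shows "summable (\<lambda>k. 1 / real (jacobsthal (n + k)))
    \<and> real (jacobsthal (n - 2)) < inverse (\<Sum>k. 1 / real (jacobsthal (n + k)))
    \<and> inverse (\<Sum>k. 1 / real (jacobsthal (n + k))) < 4 * (real (jacobsthal (n - 2)) + 1)"
proof -
  define m where "m = n - 2"
  have n: "n = m + 2"
    using assms by (simp add: m_def)
  \<comment> \<open>Half of the factor \<open>4 * jacobsthal m + 1\<close>, so that the geometric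
    bound reads \<open>2 ^ k * c \<le> jacobsthal (n + k)\<close>.\<close>
  define c where "c = 2 * real (jacobsthal m) + 1 / 2"
  have c: "c > 0"
    by (simp add: c_def)
  let ?f = "\<lambda>k. 1 / real (jacobsthal (n + k))"
  let ?g = "\<lambda>k. (1 / 2 :: real) ^ k * (1 / c)"
  have bound: "?f k \<le> ?g k" for k
  proof -
    have "2 * (2 ^ k * c) = real (2 ^ k * (4 * jacobsthal m + 1))"
      unfolding c_def of_nat_mult of_nat_add by simp
    also have "\<dots> \<le> real (2 * jacobsthal (n + k))"
      unfolding n by (rule of_nat_mono[OF jacobsthal_geometric_lower_bound])
    finally have "2 ^ k * c \<le> real (jacobsthal (n + k))"
      by simp
    hence "?f k \<le> 1 / (2 ^ k * c)"
      using c by (intro frac_le) simp_all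
    thus ?thesis
      by (simp add: power_one_over)
  qed
  have g: "?g sums (2 * (1 / c))"
    using sums_mult2[OF geometric_sums[of "1 / 2 :: real"], of "1 / c"] by simp
  have f: "summable ?f"
    by (rule summable_comparison_test'[OF sums_summable[OF g]]) (use bound in simp)
  have upper: "suminf ?f \<le> 2 / c"
    using suminf_le[OF bound f sums_summable[OF g]] sums_unique[OF g] by simp
  have lower: "1 / real (jacobsthal n) \<le> suminf ?f"
    using sum_le_suminf[OF f, of "{0}"] by simp
  have Jn: "1 \<le> jacobsthal n" "jacobsthal n \<le> 4 * jacobsthal m + 1"
    using jacobsthal_Suc_pos[of "Suc m"] jacobsthal_Suc_bounds[of m] by (auto simp: n)
  \<comment> \<open>Inverting the upper bound on the sum reverses it only if the sum is
    positive.\<close>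
  have pos: "suminf ?f > 0"
    using lower Jn(1) by (intro less_le_trans[OF _ lower]) simp
  \<comment> \<open>The gap is exactly 1/4, which makes the lower estimate strict.\<close>
  have "real (jacobsthal m) < c / 2"
    by (simp add: c_def)
  also have "\<dots> \<le> inverse (suminf ?f)"
    using le_imp_inverse_le[OF upper pos] by simp
  finally have "real (jacobsthal m) < inverse (suminf ?f)" .
  moreover have "inverse (suminf ?f) < 4 * (real (jacobsthal m) + 1)"
  proof -
    have "inverse (suminf ?f) \<le> real (jacobsthal n)"
      using le_imp_inverse_le[OF lower] Jn(1) by simp
    \<comment> \<open>This lies 3 below the claimed bound, whence strictness.\<close>
    also have "\<dots> \<le> 4 * real (jacobsthal m) + 1"
      using of_nat_mono[OF Jn(2), where ?'a = real] by simp
    finally show ?thesis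
      by simp
  qed
  ultimately show ?thesis
    using f by (simp add: m_def)
qed

end
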